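(* Let $m\in\mathbb{N}$, $\mathcal{X}=\{1,2,\ldots,m\}$, let $\mathbf{p}=(p_y)_{y\in\mathcal{X}}$ and $\mu=(\mu(x))_{x\in\mathcal{X}}$ be probability distributions on $\mathcal{X}$ with all $p_y>0$ and all $\mu(x)>0$. Let $P$ be the $m\times m$ transition matrix $P(x,y)=p_y$ and let $Q=P-I$. Put $w_x=\mu(x)/p_x$ and suppose the states are labelled so that $w_1\geq w_2\geq\cdots\geq w_m$. For $x\in\{1,\ldots,m-1\}$ and $i\in\{2,\ldots,m\}$ define $$\gamma_x=\sum_{j=x}^m\Big(\frac{\mu(j)}{w_j}-\frac{\mu(j)}{w_x}\Big),\qquad \beta_i=\sum_{j=1}^i\Big(\frac{\mu(j)}{w_j}-\frac{\mu(j)}{w_i}\Big).$$ Then the non-zero eigenvalues, with corresponding (right) eigenvectors, of $M_2(Q,\mu)$ are $(\beta_i-1,\mathbf{v}_i)_{i\in\{2,\ldots,m\}}$, and those of $M_1(Q,\mu)$ are $(\gamma_x-1,\mathbf{w}_x)_{x\in\{1,\ldots,m-1\}}$, where $$\mathbf{v}_i=\Big(-\mu(i),\ldots,-\mu(i),\underbrace{\sum_{j\leq i-1}\mu(j)}_{i\text{-th position}},0,\ldots,0\Big)^T,\qquad \mathbf{w}_x=\Big(0,\ldots,0,\underbrace{\sum_{j\geq x+1}\mu(j)}_{x\text{-th position}},-\mu(x),\ldots,-\mu(x)\Big)^T.$$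
   Context: $I$ is the $m\times m$ identity matrix. Metropolis-Hastings generators with proposal generator $Q$ and target $\mu$: for $x\neq y$, $$M_1(Q,\mu)(x,y)=\min\Big\{Q(x,y),\tfrac{\mu(y)}{\mu(x)}Q(y,x)\Big\},\qquad M_2(Q,\mu)(x,y)=\max\Big\{Q(x,y),\tfrac{\mu(y)}{\mu(x)}Q(y,x)\Big\},$$ and the diagonal entries are such that each row sums to $0$. The eigenvalues are listed with multiplicity (the remaining eigenvalue being $0$). *)

theory Defs
  imports "Jordan_Normal_Form.Char_Poly" "Jordan_Normal_Form.VS_Connect"
begin

(* Kernels and vectors are functions of the labels 1, ..., m; matrices and vectors of
   Jordan_Normal_Form count from 0, so label x sits at index x - 1. *)

definition kernel_mat :: "nat \<Rightarrow> (nat \<Rightarrow> nat \<Rightarrow> real) \<Rightarrow> real mat" where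
  "kernel_mat m K = mat m m (\<lambda>(k, l). K (Suc k) (Suc l))"

definition label_vec :: "nat \<Rightarrow> (nat \<Rightarrow> real) \<Rightarrow> real vec" where
  "label_vec m f = vec m (\<lambda>k. f (Suc k))"

definition prob_distr_on :: "nat set \<Rightarrow> (nat \<Rightarrow> real) \<Rightarrow> bool" where
  "prob_distr_on X f \<longleftrightarrow> (\<forall>x\<in>X. f x \<ge> 0) \<and> (\<Sum>x\<in>X. f x) = 1"

definition indep_kernel :: "(nat \<Rightarrow> real) \<Rightarrow> nat \<Rightarrow> nat \<Rightarrow> real" where
  "indep_kernel p x y = p y"

definition indep_generator :: "(nat \<Rightarrow> real) \<Rightarrow> nat \<Rightarrow> nat \<Rightarrow> real" where
  "indep_generator p x y = indep_kernel p x y - (if x = y then 1 else 0)"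

definition generator_of_rates :: "nat set \<Rightarrow> (nat \<Rightarrow> nat \<Rightarrow> real) \<Rightarrow> nat \<Rightarrow> nat \<Rightarrow> real" where
  "generator_of_rates X R x y = (if x = y then - (\<Sum>z\<in>X - {x}. R x z) else R x y)"

definition MH1 :: "nat set \<Rightarrow> (nat \<Rightarrow> nat \<Rightarrow> real) \<Rightarrow> (nat \<Rightarrow> real) \<Rightarrow> nat \<Rightarrow> nat \<Rightarrow> real" where
  "MH1 X Q \<mu> = generator_of_rates X (\<lambda>x y. min (Q x y) (\<mu> y / \<mu> x * Q y x))"

definition MH2 :: "nat set \<Rightarrow> (nat \<Rightarrow> nat \<Rightarrow> real) \<Rightarrow> (nat \<Rightarrow> real) \<Rightarrow> nat \<Rightarrow> nat \<Rightarrow> real" where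
  "MH2 X Q \<mu> = generator_of_rates X (\<lambda>x y. max (Q x y) (\<mu> y / \<mu> x * Q y x))"

definition gam :: "nat \<Rightarrow> (nat \<Rightarrow> real) \<Rightarrow> (nat \<Rightarrow> real) \<Rightarrow> nat \<Rightarrow> real" where
  "gam m \<mu> w x = (\<Sum>j=x..m. \<mu> j / w j - \<mu> j / w x)"

definition bet :: "(nat \<Rightarrow> real) \<Rightarrow> (nat \<Rightarrow> real) \<Rightarrow> nat \<Rightarrow> real" where
  "bet \<mu> w i = (\<Sum>j=1..i. \<mu> j / w j - \<mu> j / w i)"

definition v_vec :: "nat \<Rightarrow> (nat \<Rightarrow> real) \<Rightarrow> nat \<Rightarrow> real vec" where
  "v_vec m \<mu> i = label_vec m
     (\<lambda>z. if z < i then - \<mu> i else if z = i then (\<Sum>j=1..i - 1. \<mu> j) else 0)"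

definition w_vec :: "nat \<Rightarrow> (nat \<Rightarrow> real) \<Rightarrow> nat \<Rightarrow> real vec" where
  "w_vec m \<mu> x = label_vec m
     (\<lambda>z. if z < x then 0 else if z = x then (\<Sum>j=x + 1..m. \<mu> j) else - \<mu> x)"

(* The nonzero eigenvalues of the m x m matrix A, with multiplicity, together with corresponding
   eigenvectors are (e i, u i), i in I, and one further eigenvalue is 0.  Multiplicities are
   algebraic; when I has m - 1 elements, the m real roots of char_poly A exhaust its degree,
   so there are no non-real eigenvalues either.  Independence of the family u makes the
   eigenvectors of a repeated eigenvalue account for its multiplicity. *)
definition nonzero_eigenpairs ::
  "nat \<Rightarrow> real mat \<Rightarrow> nat set \<Rightarrow> (nat \<Rightarrow> real) \<Rightarrow> (nat \<Rightarrow> real vec) \<Rightarrow> bool" where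
  "nonzero_eigenpairs m A I e u \<longleftrightarrow>
     proots (char_poly A) = add_mset 0 {# e i. i \<in># mset_set I #} \<and>
     (\<forall>i\<in>I. e i \<noteq> 0 \<and> eigenvector A (u i) (e i)) \<and>
     inj_on u I \<and>
     \<not> LinearCombinations.module.lin_dep class_ring (module_vec TYPE(real) m) (u ` I)"

end

theory Submission
  imports Defs
begin

text \<open>
  Since \<open>p y = \<mu> y / w y\<close>, the two rates that are compared in the step from \<open>x\<close> to \<open>y\<close> are
  \<open>\<mu> y / w y\<close> and \<open>\<mu> y / w x\<close>. As \<open>w\<close> is nonincreasing along the labels, \<open>M\<^sub>2\<close> has the rate
  \<open>\<mu> y / w (max x y)\<close> and \<open>M\<^sub>1\<close> has \<open>\<mu> y / w (min x y)\<close>: up to the factor \<open>\<mu> y\<close>, only one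
  of the two labels matters.

  Take a state \<open>i\<close> and the block \<open>B\<close> of states before \<open>i\<close> (for \<open>M\<^sub>2\<close>) or after \<open>i\<close> (for
  \<open>M\<^sub>1\<close>). Seen from outside \<open>B \<union> {i}\<close>, the rates into \<open>B \<union> {i}\<close> are proportional to \<open>\<mu>\<close>; within
  \<open>B \<union> {i}\<close>, the rates between \<open>i\<close> and \<open>B\<close> are \<open>\<mu> / w i\<close>; and a state \<open>y\<close> outside
  is entered from all of \<open>B \<union> {i}\<close> at the same rate \<open>p y\<close>. Hence the function that lives on
  \<open>B \<union> {i}\<close>, is constant on \<open>B\<close> and has \<open>\<mu>\<close>-mean zero is an eigenfunction (lemma
  \<open>block_fun_eigenfunction\<close>). Its eigenvalue is \<open>-(p(C) + \<mu>(B \<union> {i}) / w i)\<close>, where \<open>C\<close> is the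
  complement of \<open>B \<union> {i}\<close>. This is negative and, because \<open>p\<close> has total mass \<open>1\<close>, equals
  \<open>\<beta>\<^sub>i - 1\<close> or \<open>\<gamma>\<^sub>i - 1\<close>.

  These functions exhaust the nonzero spectrum because they are orthogonal in \<open>L\<^sup>2(\<mu>)\<close>: the
  sets \<open>B \<union> {i}\<close> form a chain, so of two such functions the one with the larger support is constant
  on the support of the other, which has mean zero. With the constant function \<open>1\<close> they are an
  orthogonal basis of eigenfunctions, which diagonalises the generator
  (lemma \<open>nonzero_eigenpairs_orthogonal_basis\<close>).
\<close>

section \<open>Orthogonal eigenbases\<close>

text \<open>
  A left inverse of a square matrix is a right inverse, so the eigenbasis in the columns of \<open>U\<close>
  makes \<open>A\<close> similar to the diagonal matrix of its eigenvalues.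
\<close>
lemma proots_char_poly_eigenbasis:
  fixes A U W :: "'a :: field mat"
  assumes A: "A \<in> carrier_mat n n" and U: "U \<in> carrier_mat n n" and W: "W \<in> carrier_mat n n"
    and WU: "W * U = 1\<^sub>m n"
    and AU: "A * U = U * mat n n (\<lambda>(k, l). if k = l then e k else 0)"
  shows "proots (char_poly A) = image_mset e (mset_set {..<n})"
proof -
  define E where "E = mat n n (\<lambda>(k, l). if k = l then e k else (0 :: 'a))"
  have E: "E \<in> carrier_mat n n" by (simp add: E_def)
  have UW: "U * W = 1\<^sub>m n" using mat_mult_left_right_inverse[OF W U WU] .
  have "A = A * (U * W)" using A UW by simp
  also have "\<dots> = U * E * W" using assoc_mult_mat[OF A U W] AU by (simp add: E_def)
  finally have "similar_mat A E"
    using A E U W UW WU by (intro similar_matI[of A E U W n]) auto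
  then have "char_poly A = char_poly E" by (rule char_poly_similar)
  also have "\<dots> = (\<Prod>a\<leftarrow>diag_mat E. [:- a, 1:])"
    by (rule char_poly_upper_triangular[OF E]) (auto simp: upper_triangular_def E_def)
  also have "diag_mat E = map e [0..<n]" by (auto simp: diag_mat_def E_def)
  finally have "char_poly A = (\<Prod>k<n. [:- e k, 1:])"
    by (simp add: prod.distinct_set_conv_list[symmetric] o_def lessThan_atLeast0)
  then have "proots (char_poly A) = (\<Sum>k<n. {#e k#})" by (simp add: proots_prod)
  then show ?thesis by (simp add: sum_unfold_sum_mset)
qed

lemma lin_indep_cols_of_left_invertible:
  fixes U :: "real mat"
  assumes U: "U \<in> carrier_mat n n" and W: "W \<in> carrier_mat n n" and WU: "W * U = 1\<^sub>m n"
    and S: "S \<subseteq> set (cols U)"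
  shows "\<not> LinearCombinations.module.lin_dep class_ring (module_vec TYPE(real) n) S"
proof -
  interpret idom_vec n "TYPE(real)" .
  have "det W * det U = 1" using det_mult[OF W U] WU by simp
  then have "\<not> lin_dep (set (cols U))" using lin_dep_cols_imp_det_0[OF U] by auto
  then show ?thesis using subset_li_is_li S by blast
qed

lemma index_label_vec:
  assumes "x \<in> {1..m}" shows "label_vec m f $ (x - 1) = f x"
  using assms by (cases x) (auto simp: label_vec_def)

text \<open>
  Functions that are pairwise orthogonal and nonzero are linearly independent, so together with
  the constant function \<open>1\<close>, which accounts for the eigenvalue \<open>0\<close>, they form a basis of
  eigenfunctions. Orthogonality also hands over the inverse of the matrix of this basis: it is the
  transpose, with the weights \<open>\<mu>\<close> on one side and the reciprocal squared norms on the other. As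
  independence comes from orthogonality, a repeated eigenvalue gets its full multiplicity.
\<close>
lemma nonzero_eigenpairs_orthogonal_basis:
  fixes K g :: "nat \<Rightarrow> nat \<Rightarrow> real"
  assumes \<mu>_pos: "\<And>x. x \<in> {1..m} \<Longrightarrow> \<mu> x > 0"
    and z: "z \<in> {1..m}" and I: "I = {1..m} - {z}"
    and row_sum: "\<And>x. x \<in> {1..m} \<Longrightarrow> (\<Sum>y = 1..m. K x y) = 0"
    and eigen: "\<And>i x. i \<in> I \<Longrightarrow> x \<in> {1..m} \<Longrightarrow> (\<Sum>y = 1..m. K x y * g i y) = e i * g i x"
    and mean: "\<And>i. i \<in> I \<Longrightarrow> (\<Sum>x = 1..m. \<mu> x * g i x) = 0"
    and orth: "\<And>i j. i \<in> I \<Longrightarrow> j \<in> I \<Longrightarrow> i < j \<Longrightarrow> (\<Sum>x = 1..m. \<mu> x * g i x * g j x) = 0"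
    and ne: "\<And>i. i \<in> I \<Longrightarrow> \<exists>x\<in>{1..m}. g i x \<noteq> 0"
    and e: "\<And>i. i \<in> I \<Longrightarrow> e i \<noteq> 0"
  shows "nonzero_eigenpairs m (kernel_mat m K) I e (\<lambda>i. label_vec m (g i))"
proof -
  \<comment> \<open>The full basis: the constant function takes the label \<open>z\<close> that \<open>I\<close> leaves free.\<close>
  define h where "h i = (if i = z then (\<lambda>_. 1) else g i)" for i
  define d where "d i = (if i = z then 0 else e i)" for i
  define N where "N i = (\<Sum>x = 1..m. \<mu> x * h i x * h i x)" for i
  have orth': "(\<Sum>x = 1..m. \<mu> x * h i x * h j x) = 0"
    if "i \<in> {1..m}" "j \<in> {1..m}" "i \<noteq> j" for i j
  proof -
    have "(\<Sum>x = 1..m. \<mu> x * g i x * g j x) = 0" if "i \<in> I" "j \<in> I"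
    proof (cases "i < j")
      case False
      then have "(\<Sum>x = 1..m. \<mu> x * g j x * g i x) = 0" using orth that \<open>i \<noteq> j\<close> by simp
      then show ?thesis by (simp add: ac_simps)
    qed (use orth that in auto)
    then show ?thesis using that mean I by (auto simp: h_def)
  qed
  have N_pos: "N i > 0" if i: "i \<in> {1..m}" for i
  proof -
    obtain x where x: "x \<in> {1..m}" "h i x \<noteq> 0"
      using ne[of i] I i z by (cases "i = z") (auto simp: h_def)
    show ?thesis unfolding N_def
    proof (rule sum_pos2[of _ x])
      show "0 < \<mu> x * h i x * h i x" using x \<mu>_pos[of x] 
        by (metis mult.assoc mult_pos_pos not_real_square_gt_zero)
      show "0 \<le> \<mu> y * h i y * h i y" if "y \<in> {1..m}" for y
        using \<mu>_pos[OF that] by (simp add: mult.assoc)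
    qed (use x in simp_all)
  qed
  have eigen': "(\<Sum>y = 1..m. K x y * h i y) = d i * h i x" if "i \<in> {1..m}" "x \<in> {1..m}" for i x
    using that eigen row_sum I by (auto simp: h_def d_def)
  define A where "A = kernel_mat m K"
  define U where "U = mat m m (\<lambda>(k, l). h (Suc l) (Suc k))"
  define W where "W = mat m m (\<lambda>(k, l). \<mu> (Suc l) * h (Suc k) (Suc l) / N (Suc k))"
  have A: "A \<in> carrier_mat m m" and U: "U \<in> carrier_mat m m" and W: "W \<in> carrier_mat m m"
    by (simp_all add: A_def kernel_mat_def U_def W_def)
  have shift: "(\<Sum>k = 0..<m. f (Suc k)) = (\<Sum>x = 1..m. f x)" for f :: "nat \<Rightarrow> real"
    by (simp add: sum.atLeast1_atMost_eq lessThan_atLeast0)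
  have WU: "W * U = 1\<^sub>m m"
  proof (rule eq_matI)
    fix k l assume "k < dim_row (1\<^sub>m m)" "l < dim_col (1\<^sub>m m)"
    then have kl: "k < m" "l < m" by auto
    have "(W * U) $$ (k, l) = (\<Sum>j = 0..<m. \<mu> (Suc j) * h (Suc k) (Suc j) / N (Suc k) * h (Suc l) (Suc j))"
      using kl by (simp add: W_def U_def scalar_prod_def)
    also have "\<dots> = (\<Sum>x = 1..m. \<mu> x * h (Suc k) x * h (Suc l) x) / N (Suc k)"
      by (subst shift) (simp add: sum_divide_distrib)
    also have "\<dots> = 1\<^sub>m m $$ (k, l)"
    proof (cases "k = l")
      case True
      then show ?thesis using kl N_pos[of "Suc k"] by (simp add: N_def)
    next
      case False
      then show ?thesis using kl orth'[of "Suc k" "Suc l"] by simp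
    qed
    finally show "(W * U) $$ (k, l) = 1\<^sub>m m $$ (k, l)" .
  qed (use U W in auto)
  have A_col: "(\<Sum>j = 0..<m. A $$ (k, j) * h i (Suc j)) = d i * h i (Suc k)"
    if "k < m" "i \<in> {1..m}" for k i
  proof -
    have "(\<Sum>j = 0..<m. A $$ (k, j) * h i (Suc j)) = (\<Sum>j = 0..<m. K (Suc k) (Suc j) * h i (Suc j))"
      using that by (intro sum.cong) (auto simp: A_def kernel_mat_def)
    also have "\<dots> = d i * h i (Suc k)" using eigen'[of i "Suc k"] that by (subst shift) auto
    finally show ?thesis .
  qed
  have AU: "A * U = U * mat m m (\<lambda>(k, l). if k = l then d (Suc k) else 0)" (is "_ = U * ?E")
  proof (rule eq_matI)
    fix k l assume "k < dim_row (U * ?E)" "l < dim_col (U * ?E)"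
    then have kl: "k < m" "l < m" using U by auto
    have "(A * U) $$ (k, l) = (\<Sum>j = 0..<m. A $$ (k, j) * h (Suc l) (Suc j))"
      using kl A by (simp add: U_def scalar_prod_def)
    also have "\<dots> = d (Suc l) * h (Suc l) (Suc k)" using A_col[of k "Suc l"] kl by simp
    also have "\<dots> = (U * ?E) $$ (k, l)"
      using kl by (simp add: U_def scalar_prod_def if_distrib cong: if_cong)
    finally show "(A * U) $$ (k, l) = (U * ?E) $$ (k, l)" .
  qed (use A U in auto)
  have "proots (char_poly A) = image_mset (\<lambda>k. d (Suc k)) (mset_set {..<m})"
    by (rule proots_char_poly_eigenbasis[OF A U W WU AU])
  also have "\<dots> = image_mset d (image_mset Suc (mset_set {..<m}))"
    by (simp add: multiset.map_comp o_def)
  also have "image_mset Suc (mset_set {..<m}) = mset_set {1..m}"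
    by (simp add: image_mset_mset_set image_Suc_lessThan)
  also have "mset_set {1..m} = add_mset z (mset_set I)"
    using z I mset_set.remove[of "{1..m}" z] by auto
  also have "image_mset d \<dots> = add_mset 0 (image_mset e (mset_set I))"
    using I by (auto simp: d_def intro!: image_mset_cong)
  finally have roots: "proots (char_poly A) = add_mset 0 (image_mset e (mset_set I))" .
  have col: "label_vec m (g i) = col U (i - 1)" if "i \<in> I" for i
    using that I by (intro eq_vecI) (auto simp: label_vec_def U_def h_def)
  have eigvec: "eigenvector A (label_vec m (g i)) (e i)" if "i \<in> I" for i
  proof -
    have i: "i \<in> {1..m}" "h i = g i" "d i = e i" using that I by (auto simp: h_def d_def)
    obtain x where x: "x \<in> {1..m}" "g i x \<noteq> 0" using ne[OF \<open>i \<in> I\<close>] by auto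
    have "label_vec m (g i) $ (x - 1) \<noteq> 0" using x by (simp only: index_label_vec not_False_eq_True)
    moreover have "x - 1 < m" using x by auto
    ultimately have "label_vec m (g i) \<noteq> 0\<^sub>v m" by (metis index_zero_vec(1))
    moreover have "A *\<^sub>v label_vec m (g i) = e i \<cdot>\<^sub>v label_vec m (g i)"
      using A A_col[OF _ i(1)] i by (intro eq_vecI) (auto simp: label_vec_def scalar_prod_def)
    ultimately show ?thesis using A by (simp add: eigenvector_def label_vec_def)
  qed
  have inj: "inj_on (\<lambda>i. label_vec m (g i)) I"
  proof (rule inj_onI, rule ccontr)
    fix i j assume ij: "i \<in> I" "j \<in> I" "label_vec m (g i) = label_vec m (g j)" "i \<noteq> j"
    then have i: "i \<in> {1..m}" "j \<in> {1..m}" "h i = g i" "h j = g j" using I by (auto simp: h_def)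
    have "g i x = g j x" if "x \<in> {1..m}" for x
      using ij(3) index_label_vec[OF that, of "g i"] index_label_vec[OF that, of "g j"] by metis
    then have "N i = (\<Sum>x = 1..m. \<mu> x * h i x * h j x)" by (simp add: N_def i)
    then show False using orth'[of i j] N_pos[of i] i \<open>i \<noteq> j\<close> by simp
  qed
  have "(\<lambda>i. label_vec m (g i)) ` I \<subseteq> set (cols U)"
    using I U by (auto simp: col cols_def)
  then have "\<not> LinearCombinations.module.lin_dep class_ring (module_vec TYPE(real) m)
      ((\<lambda>i. label_vec m (g i)) ` I)"
    by (rule lin_indep_cols_of_left_invertible[OF U W WU])
  with roots eigvec inj e show ?thesis by (simp add: nonzero_eigenpairs_def A_def)
qed

section \<open>Eigenfunctions supported on a block\<close>

text \<open>
  The values on \<open>B\<close> and at \<open>i\<close> are balanced so that the \<open>\<mu>\<close>-mean vanishes; both families of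
  eigenvectors in the theorem have this form.
\<close>
definition block_fun :: "('a \<Rightarrow> real) \<Rightarrow> 'a set \<Rightarrow> 'a \<Rightarrow> 'a \<Rightarrow> real" where
  "block_fun \<mu> B i z = (if z \<in> B then - \<mu> i else if z = i then sum \<mu> B else 0)"

lemma sum_block_fun:
  assumes "finite X" "insert i B \<subseteq> X" "i \<notin> B"
  shows "(\<Sum>y\<in>X. f y * block_fun \<mu> B i y) = f i * sum \<mu> B - \<mu> i * sum f B"
proof -
  have B: "finite B" using finite_subset[OF assms(2,1)] by simp
  have "(\<Sum>y\<in>X. f y * block_fun \<mu> B i y) = (\<Sum>y\<in>insert i B. f y * block_fun \<mu> B i y)"
    using assms by (intro sum.mono_neutral_right) (auto simp: block_fun_def)
  also have "\<dots> = f i * block_fun \<mu> B i i + (\<Sum>y\<in>B. f y * block_fun \<mu> B i y)"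
    using B assms by simp
  also have "(\<Sum>y\<in>B. f y * block_fun \<mu> B i y) = - \<mu> i * sum f B"
    by (simp add: block_fun_def sum_distrib_left mult.commute)
  finally show ?thesis using assms by (simp add: block_fun_def)
qed

lemma block_fun_mean_zero:
  assumes "finite X" "insert i B \<subseteq> X" "i \<notin> B"
  shows "(\<Sum>x\<in>X. \<mu> x * block_fun \<mu> B i x) = 0"
  using sum_block_fun[OF assms, of \<mu> \<mu>] by simp

text \<open>
  The second function is constant on the support of the first, which has mean zero.
\<close>
lemma block_fun_orthogonal:
  assumes "finite X" "insert i B \<subseteq> X" "i \<notin> B" and nested: "insert i B \<subseteq> C"
  shows "(\<Sum>x\<in>X. \<mu> x * block_fun \<mu> B i x * block_fun \<mu> C j x) = 0"
proof -
  have "\<mu> x * block_fun \<mu> B i x * block_fun \<mu> C j x = - \<mu> j * (\<mu> x * block_fun \<mu> B i x)" for x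
    using nested by (auto simp: block_fun_def)
  then show ?thesis
    using block_fun_mean_zero[OF assms(1-3), of \<mu>] by (simp add: sum_negf sum_distrib_left[symmetric])
qed

text \<open>
  From outside \<open>B \<union> {i}\<close>, the rates into it are proportional to \<open>\<mu>\<close> and average the function
  to \<open>0\<close>. For a state in \<open>B \<union> {i}\<close>, the values inside sum up against the rates to
  \<open>K x i \<mu>(B) - \<mu> i K x B\<close>. At \<open>i\<close> the diagonal entry \<open>K i i\<close>, and in \<open>B\<close> the mass \<open>K x B\<close>,
  is the only part without a prescribed value, and the vanishing row sum determines it.
\<close>
lemma block_fun_eigenfunction:
  assumes fin: "finite X" and sub: "insert i B \<subseteq> X" and i: "i \<notin> B"
    and row_sum: "\<And>x. x \<in> X \<Longrightarrow> (\<Sum>y\<in>X. K x y) = 0"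
    and to_i: "\<And>x. x \<in> B \<Longrightarrow> K x i = \<mu> i * r"
    and from_i: "\<And>y. y \<in> B \<Longrightarrow> K i y = \<mu> y * r"
    and exit: "\<And>x y. x \<in> insert i B \<Longrightarrow> y \<in> X - insert i B \<Longrightarrow> K x y = p y"
    and enter: "\<And>x y. x \<in> X - insert i B \<Longrightarrow> y \<in> insert i B \<Longrightarrow> K x y = \<mu> y * c x"
    and x: "x \<in> X"
  shows "(\<Sum>y\<in>X. K x y * block_fun \<mu> B i y)
           = - (sum p (X - insert i B) + r * sum \<mu> (insert i B)) * block_fun \<mu> B i x"
proof -
  have B: "finite B" using finite_subset[OF sub fin] by simp
  have split: "K x i + sum (K x) B + sum (K x) (X - insert i B) = 0" if "x \<in> X" for x
    using row_sum[OF that] sum.subset_diff[OF sub fin, of "K x"] B i by simp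
  have exit_sum: "sum (K x) (X - insert i B) = sum p (X - insert i B)" if "x \<in> insert i B" for x
    using exit[OF that] by (intro sum.cong) auto
  have lhs: "(\<Sum>y\<in>X. K x y * block_fun \<mu> B i y) = K x i * sum \<mu> B - \<mu> i * sum (K x) B"
    by (rule sum_block_fun[OF fin sub i])
  consider "x \<in> X - insert i B" | "x = i" | "x \<in> B" using x by blast
  then show ?thesis
  proof cases
    case 1
    then have "sum (K x) B = c x * sum \<mu> B"
      by (simp add: sum_distrib_left mult.commute enter)
    then show ?thesis using 1 enter[OF 1, of i]
      unfolding lhs by (simp add: block_fun_def)
  next
    case 2
    have to_B: "sum (K i) B = r * sum \<mu> B" by (simp add: from_i sum_distrib_left mult.commute)
    then have diag: "K i i = - (r * sum \<mu> B + sum p (X - insert i B))"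
      using split[of i] exit_sum[of i] 2 x by simp
    show ?thesis
      unfolding 2 lhs[unfolded 2] to_B diag using i B by (simp add: block_fun_def algebra_simps)
  next
    case 3
    have to_B: "sum (K x) B = - (\<mu> i * r + sum p (X - insert i B))"
      using split[OF x] exit_sum[of x] 3 to_i by simp
    show ?thesis
      unfolding lhs to_B to_i[OF 3] using 3 i B by (simp add: block_fun_def algebra_simps)
  qed
qed

section \<open>The Metropolis-Hastings generators\<close>

lemma sum_generator_of_rates:
  assumes "finite X" "x \<in> X"
  shows "(\<Sum>y\<in>X. generator_of_rates X R x y) = 0"
proof -
  have "(\<Sum>y\<in>X - {x}. generator_of_rates X R x y) = (\<Sum>y\<in>X - {x}. R x y)"
    by (intro sum.cong) (auto simp: generator_of_rates_def)
  then show ?thesis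
    using sum.remove[OF assms, of "generator_of_rates X R x"] by (simp add: generator_of_rates_def)
qed

context
  fixes m :: nat and p \<mu> w :: "nat \<Rightarrow> real"
  assumes p_pos: "\<And>y. y \<in> {1..m} \<Longrightarrow> p y > 0" and p_sum: "sum p {1..m} = 1"
    and \<mu>_pos: "\<And>x. x \<in> {1..m} \<Longrightarrow> \<mu> x > 0"
    and w_def: "\<And>x. x \<in> {1..m} \<Longrightarrow> w x = \<mu> x / p x"
    and w_sorted: "\<And>x y. x \<in> {1..m} \<Longrightarrow> y \<in> {1..m} \<Longrightarrow> x \<le> y \<Longrightarrow> w y \<le> w x"
begin

lemma w_pos: "x \<in> {1..m} \<Longrightarrow> w x > 0"
  using w_def \<mu>_pos p_pos by simp

lemma p_eq: "x \<in> {1..m} \<Longrightarrow> p x = \<mu> x / w x"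
  using w_def \<mu>_pos[of x] p_pos[of x] by simp

text \<open>
  The rate from \<open>x\<close> to \<open>y\<close> of the time reversal of the proposal with respect to \<open>\<mu>\<close>.
\<close>
lemma reversed_rate:
  assumes "x \<in> {1..m}" shows "\<mu> y / \<mu> x * p x = \<mu> y / w x"
  using p_eq[OF assms] \<mu>_pos[OF assms] by simp

lemma rate_mono:
  assumes "x \<in> {1..m}" "y \<in> {1..m}" "z \<in> {1..m}" "x \<le> y"
  shows "\<mu> z / w x \<le> \<mu> z / w y"
  using w_sorted[OF assms(1,2,4)] w_pos[of x] w_pos[of y] \<mu>_pos[OF assms(3)] assms
  by (intro divide_left_mono) auto

lemma MH2_off_diag:
  assumes "x \<in> {1..m}" "y \<in> {1..m}" "x \<noteq> y"
  shows "MH2 {1..m} (indep_generator p) \<mu> x y = \<mu> y * (1 / w (max x y))"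
proof -
  have "MH2 {1..m} (indep_generator p) \<mu> x y = max (\<mu> y / w y) (\<mu> y / w x)"
    using assms(3) unfolding reversed_rate[OF assms(1), of y, symmetric] p_eq[OF assms(2), symmetric]
    by (simp add: MH2_def generator_of_rates_def indep_generator_def indep_kernel_def)
  also have "\<dots> = \<mu> y / w (max x y)"
    using rate_mono[OF assms(1,2,2)] rate_mono[OF assms(2,1,2)] by (cases "x \<le> y") simp_all
  finally show ?thesis by simp
qed

lemma MH1_off_diag:
  assumes "x \<in> {1..m}" "y \<in> {1..m}" "x \<noteq> y"
  shows "MH1 {1..m} (indep_generator p) \<mu> x y = \<mu> y * (1 / w (min x y))"
proof -
  have "MH1 {1..m} (indep_generator p) \<mu> x y = min (\<mu> y / w y) (\<mu> y / w x)"
    using assms(3) unfolding reversed_rate[OF assms(1), of y, symmetric] p_eq[OF assms(2), symmetric]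
    by (simp add: MH1_def generator_of_rates_def indep_generator_def indep_kernel_def)
  also have "\<dots> = \<mu> y / w (min x y)"
    using rate_mono[OF assms(1,2,2)] rate_mono[OF assms(2,1,2)] by (cases "x \<le> y") simp_all
  finally show ?thesis by simp
qed

text \<open>
  The left-hand side is the common form of \<open>\<beta>\<^sub>i - 1\<close> and \<open>\<gamma>\<^sub>i - 1\<close>, with \<open>B\<close> the states up
  to \<open>i\<close> or from \<open>i\<close> on; the right-hand side is what \<open>block_fun_eigenfunction\<close> produces. Here \<open>B\<close>
  contains \<open>i\<close> in the applications, unlike the block in \<open>block_fun\<close>.
\<close>
lemma block_eigenvalue:
  assumes "B \<subseteq> {1..m}"
  shows "(\<Sum>j\<in>B. \<mu> j / w j - \<mu> j / w i) - 1 = - (sum p ({1..m} - B) + 1 / w i * sum \<mu> B)"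
proof -
  have "(\<Sum>j\<in>B. \<mu> j / w j - \<mu> j / w i) = sum p B - 1 / w i * sum \<mu> B"
  proof -
    have "(\<Sum>j\<in>B. \<mu> j / w j) = sum p B" using assms p_eq by (intro sum.cong) auto
    then show ?thesis by (simp add: sum_subtractf sum_divide_distrib)
  qed
  then show ?thesis using sum.subset_diff[OF assms, of p] p_sum by simp
qed

lemma block_eigenvalue_neg:
  assumes "B \<subseteq> {1..m}" "i \<in> B"
  shows "(\<Sum>j\<in>B. \<mu> j / w j - \<mu> j / w i) - 1 < 0"
proof -
  have "w i > 0" using assms w_pos by auto
  have "sum \<mu> B > 0" using assms \<mu>_pos by (intro sum_pos) (auto intro: finite_subset)
  with \<open>w i > 0\<close> have "1 / w i * sum \<mu> B > 0" by simp
  moreover have "sum p ({1..m} - B) \<ge> 0" using p_pos by (intro sum_nonneg) (auto intro: less_imp_le)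
  ultimately show ?thesis
    unfolding block_eigenvalue[OF assms(1)] by linarith
qed

lemma block_fun_nonzero:
  assumes "B \<subseteq> {1..m}" "B \<noteq> {}" "i \<in> {1..m}"
  shows "\<exists>x\<in>{1..m}. block_fun \<mu> B i x \<noteq> 0"
  using assms \<mu>_pos[of i] by (auto simp: block_fun_def)

text \<open>
  The maximum of two labels is decided by the later one, so the blocks are initial segments. The
  free label for the constant function is \<open>1\<close>, whose block would be empty.
\<close>
lemma nonzero_eigenpairs_MH2:
  assumes m: "m \<ge> 1"
  shows "nonzero_eigenpairs m (kernel_mat m (MH2 {1..m} (indep_generator p) \<mu>)) {2..m}
           (\<lambda>i. bet \<mu> w i - 1) (v_vec m \<mu>)"
proof -
  let ?K = "MH2 {1..m} (indep_generator p) \<mu>"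
  let ?g = "\<lambda>i. block_fun \<mu> {1..<i} i"
  have row: "(\<Sum>y = 1..m. ?K x y) = 0" if "x \<in> {1..m}" for x
    unfolding MH2_def using that by (intro sum_generator_of_rates) auto
  have block: "insert i {1..<i} = {1..i}" if "i \<in> {2..m}" for i using that by auto
  have v: "v_vec m \<mu> = (\<lambda>i. label_vec m (?g i))"
  proof
    fix i :: nat
    have "{1..i - 1} = {1..<i}" by auto
    then show "v_vec m \<mu> i = label_vec m (?g i)"
      by (auto simp: v_vec_def label_vec_def block_fun_def)
  qed
  have "nonzero_eigenpairs m (kernel_mat m ?K) {2..m} (\<lambda>i. bet \<mu> w i - 1) (\<lambda>i. label_vec m (?g i))"
  proof (rule nonzero_eigenpairs_orthogonal_basis[where \<mu> = \<mu> and z = 1])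
    fix i x assume i: "i \<in> {2..m}" and x: "x \<in> {1..m}"
    have "(\<Sum>y = 1..m. ?K x y * ?g i y)
        = - (sum p ({1..m} - insert i {1..<i}) + 1 / w i * sum \<mu> (insert i {1..<i})) * ?g i x"
    proof (rule block_fun_eigenfunction[where c = "\<lambda>x. 1 / w x"])
      fix x y assume "x \<in> insert i {1..<i}" "y \<in> {1..m} - insert i {1..<i}"
      then show "?K x y = p y" using i by (subst MH2_off_diag) (auto simp: max_def p_eq)
    next
      fix x y assume "x \<in> {1..m} - insert i {1..<i}" "y \<in> insert i {1..<i}"
      then show "?K x y = \<mu> y * (1 / w x)" using i by (subst MH2_off_diag) (auto simp: max_def)
    next
      fix x assume "x \<in> {1..<i}"
      then show "?K x i = \<mu> i * (1 / w i)" using i by (subst MH2_off_diag) (auto simp: max_def)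
    next
      fix y assume "y \<in> {1..<i}"
      then show "?K i y = \<mu> y * (1 / w i)" using i by (subst MH2_off_diag) (auto simp: max_def)
    qed (use i x row in auto)
    then show "(\<Sum>y = 1..m. ?K x y * ?g i y) = (bet \<mu> w i - 1) * ?g i x"
      using block_eigenvalue[of "{1..i}" i] i unfolding bet_def block[OF i] by simp
  next
    fix i assume i: "i \<in> {2..m}"
    show "bet \<mu> w i - 1 \<noteq> 0"
      unfolding bet_def using i by (intro less_imp_neq block_eigenvalue_neg) auto
    show "(\<Sum>x = 1..m. \<mu> x * ?g i x) = 0" using i by (intro block_fun_mean_zero) auto
    show "\<exists>x\<in>{1..m}. ?g i x \<noteq> 0" using i by (intro block_fun_nonzero) auto
  next
    fix i j assume ij: "i \<in> {2..m}" "j \<in> {2..m}" "i < j"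
    then show "(\<Sum>x = 1..m. \<mu> x * ?g i x * ?g j x) = 0" by (intro block_fun_orthogonal) auto
  qed (use m \<mu>_pos row in auto)
  then show ?thesis by (simp only: v)
qed

text \<open>
  Mirror image of the previous lemma: the minimum is decided by the earlier label, the blocks are
  final segments, which shrink as \<open>i\<close> grows, and the free label is \<open>m\<close>.
\<close>
lemma nonzero_eigenpairs_MH1:
  assumes m: "m \<ge> 1"
  shows "nonzero_eigenpairs m (kernel_mat m (MH1 {1..m} (indep_generator p) \<mu>)) {1..m - 1}
           (\<lambda>x. gam m \<mu> w x - 1) (w_vec m \<mu>)"
proof -
  let ?K = "MH1 {1..m} (indep_generator p) \<mu>"
  let ?g = "\<lambda>i. block_fun \<mu> {i<..m} i"
  have row: "(\<Sum>y = 1..m. ?K x y) = 0" if "x \<in> {1..m}" for x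
    unfolding MH1_def using that by (intro sum_generator_of_rates) auto
  have block: "insert i {i<..m} = {i..m}" if "i \<in> {1..m - 1}" for i using that by auto
  have v: "w_vec m \<mu> = (\<lambda>i. label_vec m (?g i))"
  proof
    fix i :: nat
    have "{i + 1..m} = {i<..m}" by auto
    then show "w_vec m \<mu> i = label_vec m (?g i)"
      by (auto simp: w_vec_def label_vec_def block_fun_def)
  qed
  have "nonzero_eigenpairs m (kernel_mat m ?K) {1..m - 1} (\<lambda>i. gam m \<mu> w i - 1) (\<lambda>i. label_vec m (?g i))"
  proof (rule nonzero_eigenpairs_orthogonal_basis[where \<mu> = \<mu> and z = m])
    fix i x assume i: "i \<in> {1..m - 1}" and x: "x \<in> {1..m}"
    have "(\<Sum>y = 1..m. ?K x y * ?g i y)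
        = - (sum p ({1..m} - insert i {i<..m}) + 1 / w i * sum \<mu> (insert i {i<..m})) * ?g i x"
    proof (rule block_fun_eigenfunction[where c = "\<lambda>x. 1 / w x"])
      fix x y assume "x \<in> insert i {i<..m}" "y \<in> {1..m} - insert i {i<..m}"
      then show "?K x y = p y" using i by (subst MH1_off_diag) (auto simp: min_def p_eq)
    next
      fix x y assume "x \<in> {1..m} - insert i {i<..m}" "y \<in> insert i {i<..m}"
      then show "?K x y = \<mu> y * (1 / w x)" using i by (subst MH1_off_diag) (auto simp: min_def)
    next
      fix x assume "x \<in> {i<..m}"
      then show "?K x i = \<mu> i * (1 / w i)" using i by (subst MH1_off_diag) (auto simp: min_def)
    next
      fix y assume "y \<in> {i<..m}"
      then show "?K i y = \<mu> y * (1 / w i)" using i by (subst MH1_off_diag) (auto simp: min_def)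
    qed (use i x row in auto)
    then show "(\<Sum>y = 1..m. ?K x y * ?g i y) = (gam m \<mu> w i - 1) * ?g i x"
      using block_eigenvalue[of "{i..m}" i] i unfolding gam_def block[OF i] by simp
  next
    fix i assume i: "i \<in> {1..m - 1}"
    show "gam m \<mu> w i - 1 \<noteq> 0"
      unfolding gam_def using i by (intro less_imp_neq block_eigenvalue_neg) auto
    show "(\<Sum>x = 1..m. \<mu> x * ?g i x) = 0" using i by (intro block_fun_mean_zero) auto
    show "\<exists>x\<in>{1..m}. ?g i x \<noteq> 0" using i by (intro block_fun_nonzero) auto
  next
    fix i j assume ij: "i \<in> {1..m - 1}" "j \<in> {1..m - 1}" "i < j"
    have "(\<Sum>x = 1..m. \<mu> x * ?g j x * ?g i x) = 0"
      using ij by (intro block_fun_orthogonal) auto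
    then show "(\<Sum>x = 1..m. \<mu> x * ?g i x * ?g j x) = 0" by (simp add: ac_simps)
  qed (use m \<mu>_pos row in auto)
  then show ?thesis by (simp only: v)
qed

end

theorem proposition5p1:
  fixes m :: nat and p \<mu> w :: "nat \<Rightarrow> real" and Q :: "nat \<Rightarrow> nat \<Rightarrow> real"
  assumes p_distr: "prob_distr_on {1..m} p" and p_pos: "\<forall>y\<in>{1..m}. p y > 0"
    and mu_distr: "prob_distr_on {1..m} \<mu>" and mu_pos: "\<forall>x\<in>{1..m}. \<mu> x > 0"
    and Q_def: "Q = indep_generator p"
    and w_def: "\<forall>x\<in>{1..m}. w x = \<mu> x / p x"
    and w_sorted: "\<forall>x\<in>{1..m}. \<forall>y\<in>{1..m}. x \<le> y \<longrightarrow> w x \<ge> w y"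
  shows "nonzero_eigenpairs m (kernel_mat m (MH2 {1..m} Q \<mu>)) {2..m}
           (\<lambda>i. bet \<mu> w i - 1) (v_vec m \<mu>) \<and>
         nonzero_eigenpairs m (kernel_mat m (MH1 {1..m} Q \<mu>)) {1..m - 1}
           (\<lambda>x. gam m \<mu> w x - 1) (w_vec m \<mu>)"
proof -
  have p_sum: "sum p {1..m} = 1" using p_distr by (simp add: prob_distr_on_def)
  then have "m \<ge> 1" by (cases m) auto
  then show ?thesis
    unfolding Q_def
    using p_sum p_pos mu_pos w_def w_sorted
    by (intro conjI nonzero_eigenpairs_MH2 nonzero_eigenpairs_MH1) auto
qed

end
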